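(* Let $R$ be a commutative ring with unity with no nontrivial idempotents, such that $\mathrm{Cl}(R)$ is finite. Then: (i) If $|U(R)|=1$, then $\mathrm{sdim}(\mathrm{Cl}(R))=1$. (ii) If $|U(R)|\ge 2$, then $\mathrm{sdim}(\mathrm{Cl}(R))=2|U(R)|-2$.
   Context: $U(R)$ is the set of units, $\mathrm{Id}(R)$ the set of idempotents; a nontrivial idempotent is one different from $0,1$. The clean graph $\mathrm{Cl}(R)$ has vertex set $\{(e,u): e\in\mathrm{Id}(R), u\in U(R)\}$, two distinct vertices $(e,u),(f,v)$ being adjacent iff $ef=0$ or $uv=1$; it is finite if its vertex set is finite. In a graph, a vertex $w$ strongly resolves vertices $x,y$ if some shortest $x$–$w$ path contains $y$ or some shortest $y$–$w$ path contains $x$; a strong resolving set is a set $S$ of vertices such that every two distinct vertices are strongly resolved by some vertex of $S$; $\mathrm{sdim}$ is the smallest cardinality of a strong resolving set. *)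

theory Defs
  imports "HOL-Algebra.Ring" "Graph_Theory.Graph_Theory"
begin

definition idempotents :: "('a, 'b) ring_scheme \<Rightarrow> 'a set" where
  "idempotents R = {e \<in> carrier R. e \<otimes>\<^bsub>R\<^esub> e = e}"

text \<open>An undirected simple graph is represented as a loop-free symmetric digraph, each edge
  being a pair of opposite arcs.\<close>

definition clean_graph :: "('a, 'b) ring_scheme \<Rightarrow> ('a \<times> 'a) pair_pre_digraph" where
  "clean_graph R =
     \<lparr> pverts = idempotents R \<times> Units R,
       parcs = {((e, u), (f, v)) | e u f v.
         (e, u) \<in> idempotents R \<times> Units R \<and> (f, v) \<in> idempotents R \<times> Units R \<and>
         (e, u) \<noteq> (f, v) \<and> (e \<otimes>\<^bsub>R\<^esub> f = \<zero>\<^bsub>R\<^esub> \<or> u \<otimes>\<^bsub>R\<^esub> v = \<one>\<^bsub>R\<^esub>)} \<rparr>"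

lemma clean_graph_bidirected:
  assumes "cring R"
  shows "pair_bidirected_digraph (clean_graph R)"
proof -
  interpret cring R by fact
  show ?thesis
  proof unfold_locales
    show "symmetric (clean_graph R)"
      by (auto simp: symmetric_def sym_def clean_graph_def idempotents_def Units_def m_comm)
  qed (auto simp: clean_graph_def)
qed

definition shortest_vpath :: "('a, 'b) pre_digraph \<Rightarrow> 'a \<Rightarrow> 'a vwalk \<Rightarrow> 'a \<Rightarrow> bool" where
  "shortest_vpath G x p y \<longleftrightarrow>
     vpath p G \<and> hd p = x \<and> last p = y \<and>
     (\<forall>q. vpath q G \<and> hd q = x \<and> last q = y \<longrightarrow> vwalk_length p \<le> vwalk_length q)"

definition strongly_resolves :: "('a, 'b) pre_digraph \<Rightarrow> 'a \<Rightarrow> 'a \<Rightarrow> 'a \<Rightarrow> bool" where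
  "strongly_resolves G w x y \<longleftrightarrow>
     (\<exists>p. shortest_vpath G x p w \<and> y \<in> set p) \<or> (\<exists>p. shortest_vpath G y p w \<and> x \<in> set p)"

definition strong_resolving_set :: "('a, 'b) pre_digraph \<Rightarrow> 'a set \<Rightarrow> bool" where
  "strong_resolving_set G S \<longleftrightarrow>
     S \<subseteq> verts G \<and>
     (\<forall>x \<in> verts G. \<forall>y \<in> verts G. x \<noteq> y \<longrightarrow> (\<exists>w \<in> S. strongly_resolves G w x y))"

text \<open>Only finite sets are counted, because \<^const>\<open>card\<close> is 0 on infinite ones.\<close>

definition sdim :: "('a, 'b) pre_digraph \<Rightarrow> nat" where
  "sdim G = (LEAST k. \<exists>S. strong_resolving_set G S \<and> finite S \<and> card S = k)"

end

theory Submission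
  imports Defs
begin

text \<open>Every \<open>(0, u)\<close> is adjacent to all other vertices, so the clean graph has diameter at most 2,
  and \<open>w\<close> outside \<open>{x, y}\<close> strongly resolves \<open>x\<close>, \<open>y\<close> only if \<open>x\<close> and \<open>y\<close> are adjacent and exactly
  one of them is adjacent to \<open>w\<close>. This never happens within the layer of the \<open>(0, u)\<close>, nor within
  that of the \<open>(1, u)\<close>, where a vertex has at most one neighbour. Hence a strong resolving set misses
  at most one vertex per layer. Conversely, omitting just \<open>(0, 1)\<close> and \<open>(1, 1)\<close> works: for a unit
  \<open>t \<noteq> 1\<close> the vertex \<open>(1, t)\<close> is not adjacent to \<open>(1, 1)\<close>, and \<open>(1, 1), (0, 1), (1, t)\<close> is a
  shortest path.\<close>

text \<open>If two distinct members of \<open>A\<close> both lay outside \<open>S\<close>, the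
  vertex of \<open>S\<close> resolving them would be one of the two. So \<open>A - S\<close> has at
  most one element.\<close>

lemma strong_resolving_set_card_le:
  assumes "strong_resolving_set G S" and "A \<subseteq> verts G" and "finite A"
    and only: "\<And>x y w. x \<in> A \<Longrightarrow> y \<in> A \<Longrightarrow> x \<noteq> y \<Longrightarrow> w \<in> verts G \<Longrightarrow>
      strongly_resolves G w x y \<Longrightarrow> w = x \<or> w = y"
  shows "card A \<le> Suc (card (A \<inter> S))"
proof -
  have S: "S \<subseteq> verts G"
    and resolves: "\<And>x y. x \<in> verts G \<Longrightarrow> y \<in> verts G \<Longrightarrow> x \<noteq> y \<Longrightarrow> \<exists>w\<in>S. strongly_resolves G w x y"
    using assms(1) by (auto simp: strong_resolving_set_def)
  have "x = y" if xy: "x \<in> A - S" "y \<in> A - S" for x y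
  proof (rule ccontr)
    assume "x \<noteq> y"
    moreover have "x \<in> verts G" "y \<in> verts G" using xy assms(2) by auto
    ultimately obtain w where w: "w \<in> S" "strongly_resolves G w x y"
      using resolves[of x y] by auto
    then have "w = x \<or> w = y"
      using xy \<open>x \<noteq> y\<close> S by (intro only) auto
    with w(1) xy show False by auto
  qed
  then have "card (A - S) \<le> Suc 0"
    using \<open>finite A\<close> by (auto simp: card_le_Suc0_iff_eq)
  moreover have "card A = card (A \<inter> S) + card (A - S)"
    using \<open>finite A\<close> by (simp add: card_Int_Diff)
  ultimately show ?thesis by simp
qed

lemma sdim_eqI:
  assumes "strong_resolving_set G S" and "finite S"
    and "\<And>T. strong_resolving_set G T \<Longrightarrow> finite T \<Longrightarrow> card S \<le> card T"
  shows "sdim G = card S"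
  unfolding sdim_def using assms by (intro Least_equality) auto

context loopfree_digraph
begin

lemma vpath_length_ge_2:
  assumes "vpath p G" and "hd p \<noteq> last p"
  shows "length p \<ge> 2"
  using assms by (cases p rule: remdups_adj.cases) (auto simp: vpath_def vwalk_def)

lemma vpath_length_ge_3:
  assumes "vpath p G" and "hd p \<noteq> last p" and "\<not> hd p \<rightarrow>\<^bsub>G\<^esub> last p"
  shows "length p \<ge> 3"
proof (rule ccontr)
  assume "\<not> length p \<ge> 3"
  with vpath_length_ge_2[OF assms(1,2)] have "length p = Suc (Suc 0)" by simp
  then obtain a b where "p = [a, b]" by (auto simp: length_Suc_conv)
  with assms show False by (auto simp: vpath_def vwalk_def)
qed

lemma shortest_vpath_arc:
  assumes "x \<rightarrow>\<^bsub>G\<^esub> y"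
  shows "shortest_vpath G x [x, y] y"
proof -
  have "x \<noteq> y" using assms adj_not_same by blast
  then show ?thesis
    unfolding shortest_vpath_def using vpathI_arc[OF assms] vpath_length_ge_2 by fastforce
qed

lemma shortest_vpath_via:
  assumes "x \<rightarrow>\<^bsub>G\<^esub> z" and "z \<rightarrow>\<^bsub>G\<^esub> y" and "x \<noteq> y" and "\<not> x \<rightarrow>\<^bsub>G\<^esub> y"
  shows "shortest_vpath G x [x, z, y] y"
proof -
  have "vpath [x, z, y] G"
    using assms adj_in_verts adj_not_same by (auto simp: vpath_def vwalk_def)
  then show ?thesis
    unfolding shortest_vpath_def using assms vpath_length_ge_3 by fastforce
qed

end

text \<open>A universal vertex \<open>z\<close> bounds all distances by 2, the only global feature
  of the clean graph that the path arguments use.\<close>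

locale hub_digraph = loopfree_digraph G for G :: "('a, 'b) pre_digraph" +
  fixes z :: 'a
  assumes hub: "x \<in> verts G \<Longrightarrow> x \<noteq> z \<Longrightarrow> x \<rightarrow>\<^bsub>G\<^esub> z \<and> z \<rightarrow>\<^bsub>G\<^esub> x"
begin

lemma shortest_vpath_exists:
  assumes "x \<in> verts G" and "y \<in> verts G" and "x \<noteq> y"
  shows "\<exists>p. shortest_vpath G x p y"
proof (cases "x \<rightarrow>\<^bsub>G\<^esub> y")
  case True
  then show ?thesis using shortest_vpath_arc by blast
next
  case False
  with assms hub have "x \<noteq> z" "y \<noteq> z" by auto
  with False assms hub show ?thesis using shortest_vpath_via[of x z y] by blast
qed

lemma strongly_resolves_self:
  assumes "x \<in> verts G" and "y \<in> verts G" and "x \<noteq> y"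
  shows "strongly_resolves G x x y" and "strongly_resolves G y x y"
proof -
  have "\<exists>p. shortest_vpath G a p b \<and> b \<in> set p" if "a \<in> verts G" "b \<in> verts G" "a \<noteq> b" for a b
    using shortest_vpath_exists[OF that]
    unfolding shortest_vpath_def vpath_def vwalk_def by (metis last_in_set)
  with assms show "strongly_resolves G x x y" "strongly_resolves G y x y"
    unfolding strongly_resolves_def by metis+
qed

lemma shortest_vpath_interior:
  assumes p: "shortest_vpath G x p w" and y: "y \<in> set p" "y \<noteq> x" "y \<noteq> w"
  shows "x \<rightarrow>\<^bsub>G\<^esub> y \<and> y \<rightarrow>\<^bsub>G\<^esub> w \<and> \<not> x \<rightarrow>\<^bsub>G\<^esub> w"
proof -
  have vp: "vpath p G" "hd p = x" "last p = w"
    and min: "\<And>q. vpath q G \<Longrightarrow> hd q = x \<Longrightarrow> last q = w \<Longrightarrow> length p - 1 \<le> length q - 1"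
    using p by (auto simp: shortest_vpath_def)
  have xw: "x \<in> verts G" "w \<in> verts G"
    using vp by (auto simp: vpath_def vwalk_def)
  \<comment> \<open>A list of one or two vertices contains only its ends, and \<open>y\<close> is
    neither of them.\<close>
  have len: "length p \<ge> 3"
    using vp y by (cases p rule: remdups_adj.cases) (auto simp: vpath_def Suc_le_eq split: if_splits)
  \<comment> \<open>Otherwise the trivial path \<open>[x]\<close>, of length 0, would be shorter
    than \<open>p\<close>.\<close>
  have "x \<noteq> w"
    using min[of "[x]"] xw len by (auto simp: vpath_def vwalk_def)
  moreover have na: "\<not> x \<rightarrow>\<^bsub>G\<^esub> w"
    using min[of "[x, w]"] vpathI_arc[of x w] len by auto
  \<comment> \<open>Neither end is the hub, since the hub would supply the excluded arc from
    \<open>x\<close> to \<open>w\<close>. The detour through \<open>z\<close> now forces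
    \<open>p\<close> to have exactly three vertices.\<close>
  ultimately have "vpath [x, z, w] G"
    using shortest_vpath_via[of x z w] hub xw unfolding shortest_vpath_def by blast
  then have "length p = Suc (Suc (Suc 0))" using min[of "[x, z, w]"] len by simp
  then obtain a b c where "p = [a, b, c]" by (auto simp: length_Suc_conv)
  with vp y na show ?thesis by (auto simp: vpath_def vwalk_def)
qed

text \<open>By \<open>shortest_vpath_interior\<close>, a resolving \<open>w\<close> other than
  \<open>x\<close> and \<open>y\<close> makes them adjacent, with exactly one of them adjacent to
  \<open>w\<close>. So the second premise need only be checked for adjacent pairs.\<close>

lemma strongly_resolves_imp_endpoint:
  assumes "strongly_resolves G w x y"
    and "x \<rightarrow>\<^bsub>G\<^esub> y \<or> y \<rightarrow>\<^bsub>G\<^esub> x \<Longrightarrow> w \<noteq> x \<Longrightarrow> w \<noteq> y \<Longrightarrow> x \<rightarrow>\<^bsub>G\<^esub> w \<longleftrightarrow> y \<rightarrow>\<^bsub>G\<^esub> w"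
    and "x \<noteq> y"
  shows "w = x \<or> w = y"
proof (rule ccontr)
  assume w: "\<not> (w = x \<or> w = y)"
  from assms(1) consider p where "shortest_vpath G x p w" "y \<in> set p"
    | p where "shortest_vpath G y p w" "x \<in> set p"
    unfolding strongly_resolves_def by blast
  then show False
  proof cases
    case 1
    with shortest_vpath_interior[of x _ w y] assms(2,3) w show False by simp
  next
    case 2
    with shortest_vpath_interior[of y _ w x] assms(2,3) w show False by simp
  qed
qed

end

theorem theorem4p4:
  fixes R :: "('a, 'b) ring_scheme"
  assumes "cring R"
    and "\<one>\<^bsub>R\<^esub> \<noteq> \<zero>\<^bsub>R\<^esub>"
    and "\<not> (\<exists>e \<in> idempotents R. e \<noteq> \<zero>\<^bsub>R\<^esub> \<and> e \<noteq> \<one>\<^bsub>R\<^esub>)"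
    and "finite (pverts (clean_graph R))"
  shows "(card (Units R) = 1 \<longrightarrow> sdim (clean_graph R) = 1) \<and>
         (card (Units R) \<ge> 2 \<longrightarrow> sdim (clean_graph R) = 2 * card (Units R) - 2)"
proof -
  interpret cring R by fact
  let ?G = "with_proj (clean_graph R)"
  let ?U = "Units R"
  let ?Z = "{\<zero>\<^bsub>R\<^esub>} \<times> ?U" and ?O = "{\<one>\<^bsub>R\<^esub>} \<times> ?U"
  interpret B: pair_bidirected_digraph "clean_graph R"
    by (rule clean_graph_bidirected) fact
  have idem: "idempotents R = {\<zero>\<^bsub>R\<^esub>, \<one>\<^bsub>R\<^esub>}"
    using assms(3) by (auto simp: idempotents_def)
  then have verts: "pverts (clean_graph R) = ?Z \<union> ?O"
    by (auto simp: clean_graph_def)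
  \<comment> \<open>For idempotents taken from 0 and 1, with 1 different from 0, a product vanishes
    exactly when a factor is 0.\<close>
  have adj: "((e, u), (f, v)) \<in> parcs (clean_graph R) \<longleftrightarrow> (e, u) \<in> verts ?G \<and> (f, v) \<in> verts ?G \<and> (e, u) \<noteq> (f, v) \<and>
      (e = \<zero>\<^bsub>R\<^esub> \<or> f = \<zero>\<^bsub>R\<^esub> \<or> u \<otimes>\<^bsub>R\<^esub> v = \<one>\<^bsub>R\<^esub>)" for e u f v
    using assms(2) by (auto simp: clean_graph_def idem)
  have finite_U: "finite ?U"
    using assms(4) idem by (auto simp: clean_graph_def dest: finite_cartesian_productD2)
  interpret hub_digraph ?G "(\<zero>\<^bsub>R\<^esub>, \<one>\<^bsub>R\<^esub>)"
    by unfold_locales (auto simp: adj verts)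
  have lower: "2 * card ?U - 2 \<le> card T" if T: "strong_resolving_set ?G T" "finite T" for T
  proof -
    have "card ?Z \<le> Suc (card (?Z \<inter> T))"
    proof (rule strong_resolving_set_card_le[OF T(1)])
      fix x y w
      assume *: "x \<in> ?Z" "y \<in> ?Z" "x \<noteq> y" "w \<in> verts ?G" "strongly_resolves ?G w x y"
      \<comment> \<open>Both sides hold, because a vertex of \<open>?Z\<close> is adjacent to every
        other vertex.\<close>
      then have "x \<rightarrow>\<^bsub>?G\<^esub> w \<longleftrightarrow> y \<rightarrow>\<^bsub>?G\<^esub> w" if "w \<noteq> x" "w \<noteq> y"
        using that by (cases w) (auto simp: adj verts)
      with * show "w = x \<or> w = y" by (intro strongly_resolves_imp_endpoint) auto
    qed (use finite_U verts in auto)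
    moreover have "card ?O \<le> Suc (card (?O \<inter> T))"
    proof (rule strong_resolving_set_card_le[OF T(1)])
      fix x y w
      assume *: "x \<in> ?O" "y \<in> ?O" "x \<noteq> y" "w \<in> verts ?G" "strongly_resolves ?G w x y"
      then obtain u v where uv: "x = (\<one>\<^bsub>R\<^esub>, u)" "y = (\<one>\<^bsub>R\<^esub>, v)" "u \<in> ?U" "v \<in> ?U" by auto
      have "x \<rightarrow>\<^bsub>?G\<^esub> w \<longleftrightarrow> y \<rightarrow>\<^bsub>?G\<^esub> w"
        if "x \<rightarrow>\<^bsub>?G\<^esub> y \<or> y \<rightarrow>\<^bsub>?G\<^esub> x" "w \<noteq> x" "w \<noteq> y"
      proof -
        \<comment> \<open>Within \<open>?O\<close> adjacency can only come from the units, so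
          \<open>u\<close> and \<open>v\<close> are mutually inverse.\<close>
        have "u \<otimes>\<^bsub>R\<^esub> v = \<one>\<^bsub>R\<^esub>"
          using that(1) uv assms(2) m_comm[OF Units_closed Units_closed, of u v] by (auto simp: adj)
        then have vu: "v \<otimes>\<^bsub>R\<^esub> u = \<one>\<^bsub>R\<^esub>"
          using uv by (simp add: m_comm Units_closed)
        consider s where "w = (\<zero>\<^bsub>R\<^esub>, s)" "s \<in> ?U" | t where "w = (\<one>\<^bsub>R\<^esub>, t)" "t \<in> ?U"
          using *(4) verts by auto
        then show ?thesis
        proof cases
          case 1
          then show ?thesis using uv assms(2) by (simp add: adj verts)
        next
          case (2 t)
          with that(2,3) uv have "t \<noteq> u" "t \<noteq> v" by auto
          \<comment> \<open>Inverses are unique: \<open>t\<close> inverse to \<open>u\<close> would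
            equal \<open>v\<close>, and \<open>t\<close> inverse to \<open>v\<close> would equal
            \<open>u\<close>. So neither vertex is adjacent to \<open>w\<close>.\<close>
          then have "u \<otimes>\<^bsub>R\<^esub> t \<noteq> \<one>\<^bsub>R\<^esub>" "v \<otimes>\<^bsub>R\<^esub> t \<noteq> \<one>\<^bsub>R\<^esub>"
            using \<open>u \<otimes>\<^bsub>R\<^esub> v = \<one>\<^bsub>R\<^esub>\<close> vu uv 2(2) by (metis Units_closed Units_l_cancel)+
          then show ?thesis using uv 2 assms(2) by (simp add: adj)
        qed
      qed
      with * show "w = x \<or> w = y" by (intro strongly_resolves_imp_endpoint) auto
    qed (use finite_U verts in auto)
    \<comment> \<open>The layers are disjoint because 1 differs from 0, so their two bounds add
      up.\<close>
    moreover have "card (?Z \<inter> T) + card (?O \<inter> T) \<le> card T"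
      using T(2) assms(2)
      by (subst card_Un_disjoint[symmetric]) (auto intro!: card_mono)
    ultimately show ?thesis by (simp add: card_cartesian_product)
  qed
  show ?thesis
  proof (intro conjI impI)
    assume "card ?U = 1"
    then have U: "?U = {\<one>\<^bsub>R\<^esub>}"
      by (metis Units_one_closed card_1_singletonE singletonD)
    let ?S = "{(\<zero>\<^bsub>R\<^esub>, \<one>\<^bsub>R\<^esub>)}"
    have "sdim ?G = card ?S"
    proof (rule sdim_eqI)
      show "strong_resolving_set ?G ?S"
        unfolding strong_resolving_set_def
        using strongly_resolves_self by (auto simp: verts U)
      \<comment> \<open>For a single unit \<open>lower\<close> yields only 0. The bound 1 holds
        because the two distinct vertices must be resolved by some member of
        \<open>T\<close>.\<close>
      fix T assume "strong_resolving_set ?G T" "finite T"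
      then have "T \<noteq> {}"
        using assms(2) by (auto simp: strong_resolving_set_def verts U)
      with \<open>finite T\<close> show "card ?S \<le> card T" by (simp add: Suc_le_eq card_gt_0_iff)
    qed simp
    then show "sdim ?G = 1" by simp
  next
    assume two: "card ?U \<ge> 2"
    obtain t where t: "t \<in> ?U" "t \<noteq> \<one>\<^bsub>R\<^esub>"
    proof -
      have "\<not> ?U \<subseteq> {\<one>\<^bsub>R\<^esub>}"
        using two card_mono[of "{\<one>\<^bsub>R\<^esub>}" ?U] by auto
      then show ?thesis using that by blast
    qed
    let ?a = "(\<zero>\<^bsub>R\<^esub>, \<one>\<^bsub>R\<^esub>)" and ?b = "(\<one>\<^bsub>R\<^esub>, \<one>\<^bsub>R\<^esub>)" and ?w = "(\<one>\<^bsub>R\<^esub>, t)"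
    let ?S = "verts ?G - {?a, ?b}"
    \<comment> \<open>\<open>?b\<close> and \<open>?w\<close> are not adjacent, since the product of
      their units is \<open>t\<close>, which is not 1. The path passes through \<open>?a\<close>, so
      \<open>?w\<close> resolves the omitted pair.\<close>
    have "shortest_vpath ?G ?b [?b, ?a, ?w] ?w"
      using t assms(2) by (intro B.shortest_vpath_via) (auto simp: adj verts)
    then have ab: "strongly_resolves ?G ?w ?a ?b" "strongly_resolves ?G ?w ?b ?a"
      by (force simp: strongly_resolves_def)+
    have card_S: "card ?S = 2 * card ?U - 2"
    proof -
      have "card (verts ?G) = card ?Z + card ?O"
        unfolding with_proj_simps verts using finite_U assms(2) by (intro card_Un_disjoint) auto
      moreover have "card ?S = card (verts ?G) - card {?a, ?b}"
        by (rule card_Diff_subset) (auto simp: verts)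
      ultimately show ?thesis
        using assms(2) by (simp add: card_cartesian_product)
    qed
    have "sdim ?G = card ?S"
    proof (rule sdim_eqI)
      have "\<exists>w\<in>?S. strongly_resolves ?G w x y"
        if xy: "x \<in> verts ?G" "y \<in> verts ?G" "x \<noteq> y" for x y
      proof -
        \<comment> \<open>A pair meeting \<open>?S\<close> is resolved by its own member there; for
          the omitted pair \<open>?w\<close> serves, lying in \<open>?S\<close> because
          \<open>t\<close> is not 1.\<close>
        consider "x \<in> ?S" | "y \<in> ?S" | "x = ?a" "y = ?b" | "x = ?b" "y = ?a"
          using xy by blast
        then show ?thesis
        proof cases
          case 1
          then show ?thesis using strongly_resolves_self(1)[OF xy] by (rule rev_bexI)
        next
          case 2
          then show ?thesis using strongly_resolves_self(2)[OF xy] by (rule rev_bexI)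
        qed (use ab t verts in auto)
      qed
      then show "strong_resolving_set ?G ?S"
        unfolding strong_resolving_set_def by blast
    qed (use finite_U lower card_S in \<open>auto simp: verts\<close>)
    then show "sdim ?G = 2 * card ?U - 2" using card_S by simp
  qed
qed

end
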